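(* If $p\in[2,\infty)$, $n\in\mathbb N$, $\mathbb K\in\{\mathbb R,\mathbb C\}$, and $h:\Omega_n\to\mathbb K$ satisfies $\mathbb E h=0$, then $$\left\|\left(\sum_{j=1}^n|D_j\Delta^{-1}h|^2\right)^{1/2}\right\|_{L_p(\Omega_n)}\le\frac\pi2\,\|h\|_{L_p(\Omega_n)} .$$ In particular, the constant $\pi/2$ is independent of $n$ and $p$.
   Context: $[n]=\{1,\dots,n\}$, $\Omega_n=\{-1,1\}^n$ with the uniform probability measure, $\mathbb E$ the average over $\Omega_n$, $\|h\|_{L_p(\Omega_n)}=(\mathbb E|h|^p)^{1/p}$. For $A\subseteq[n]$, $W_A(\varepsilon)=\prod_{j\in A}\varepsilon_j$ (with $W_\varnothing\equiv1$) and $\widehat h(A)=\mathbb E_\varepsilon[h(\varepsilon)W_A(\varepsilon)]$, so that $h=\sum_A\widehat h(A)W_A$. If $\varepsilon^{(j)}$ is $\varepsilon$ with the sign of its $j$th coordinate changed, $D_jh(\varepsilon)=\frac12\bigl(h(\varepsilon)-h(\varepsilon^{(j)})\bigr)$. $\Delta=\sum_{j=1}^nD_j$, so $\Delta W_A=|A|W_A$, and for mean-zero $h$, $\Delta^{-1}h=\sum_{\varnothing\ne A\subseteq[n]}|A|^{-1}\widehat h(A)W_A$. *)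

theory Defs
  imports Complex_Main "HOL-Library.FuncSet"
begin

text \<open>
  The index set is \<open>{1..n}\<close>; points of the cube are extensional functions, so that there are
  exactly \<open>2 ^ n\<close> of them. A function on the cube is a function on \<open>nat \<Rightarrow> real\<close> of which
  only the values on \<open>cube n\<close> matter.
\<close>

definition cube :: "nat \<Rightarrow> (nat \<Rightarrow> real) set" where
  "cube n = ({1..n} \<rightarrow>\<^sub>E {-1, 1})"

definition expect :: "nat \<Rightarrow> ((nat \<Rightarrow> real) \<Rightarrow> 'a::real_vector) \<Rightarrow> 'a" where
  "expect n h = (\<Sum>\<epsilon>\<in>cube n. h \<epsilon>) /\<^sub>R real (card (cube n))"

definition Lp_norm :: "nat \<Rightarrow> real \<Rightarrow> ((nat \<Rightarrow> real) \<Rightarrow> 'a::real_normed_vector) \<Rightarrow> real" where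
  "Lp_norm n p h = expect n (\<lambda>\<epsilon>. norm (h \<epsilon>) powr p) powr (1 / p)"

definition walsh :: "nat set \<Rightarrow> (nat \<Rightarrow> real) \<Rightarrow> real" where
  "walsh A \<epsilon> = (\<Prod>j\<in>A. \<epsilon> j)"

definition fourier_coeff ::
    "nat \<Rightarrow> ((nat \<Rightarrow> real) \<Rightarrow> 'a::real_vector) \<Rightarrow> nat set \<Rightarrow> 'a" where
  "fourier_coeff n h A = expect n (\<lambda>\<epsilon>. walsh A \<epsilon> *\<^sub>R h \<epsilon>)"

definition discrete_deriv ::
    "nat \<Rightarrow> ((nat \<Rightarrow> real) \<Rightarrow> 'a::real_vector) \<Rightarrow> (nat \<Rightarrow> real) \<Rightarrow> 'a" where
  "discrete_deriv j h \<epsilon> = (1 / 2) *\<^sub>R (h \<epsilon> - h (\<epsilon>(j := - \<epsilon> j)))"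

definition laplacian ::
    "nat \<Rightarrow> ((nat \<Rightarrow> real) \<Rightarrow> 'a::real_vector) \<Rightarrow> (nat \<Rightarrow> real) \<Rightarrow> 'a" where
  "laplacian n h \<epsilon> = (\<Sum>j=1..n. discrete_deriv j h \<epsilon>)"

text \<open>Inverts the Laplacian on mean-zero functions on the cube, by \<open>laplacian_walsh\<close> below; the empty set (the mean) is omitted from the sum.\<close>

definition laplacian_inv ::
    "nat \<Rightarrow> ((nat \<Rightarrow> real) \<Rightarrow> 'a::real_vector) \<Rightarrow> (nat \<Rightarrow> real) \<Rightarrow> 'a" where
  "laplacian_inv n h \<epsilon> =
     (\<Sum>A\<in>Pow {1..n} - {{}}. (1 / real (card A)) *\<^sub>R (walsh A \<epsilon> *\<^sub>R fourier_coeff n h A))"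

lemma discrete_deriv_walsh:
  assumes "finite A"
  shows "discrete_deriv j (walsh A) \<epsilon> = (if j \<in> A then walsh A \<epsilon> else 0)"
proof (cases "j \<in> A")
  case True
  have "(\<Prod>i\<in>A - {j}. (\<epsilon>(j := - \<epsilon> j)) i) = (\<Prod>i\<in>A - {j}. \<epsilon> i)"
    by (rule prod.cong) auto
  then show ?thesis
    using True assms by (simp add: discrete_deriv_def walsh_def prod.remove[of A j])
next
  case False
  have "(\<Prod>i\<in>A. (\<epsilon>(j := - \<epsilon> j)) i) = (\<Prod>i\<in>A. \<epsilon> i)"
    by (rule prod.cong) (use False in auto)
  then show ?thesis
    using False by (simp add: discrete_deriv_def walsh_def)
qed

lemma laplacian_walsh:
  assumes "A \<subseteq> {1..n}"
  shows "laplacian n (walsh A) \<epsilon> = real (card A) * walsh A \<epsilon>"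
proof -
  have "finite A"
    using assms finite_subset by blast
  then have "laplacian n (walsh A) \<epsilon> = (\<Sum>j\<in>{1..n}. if j \<in> A then walsh A \<epsilon> else 0)"
    by (simp add: laplacian_def discrete_deriv_walsh)
  also have "\<dots> = (\<Sum>j\<in>{1..n} \<inter> A. walsh A \<epsilon>)"
    by (simp only: sum.inter_restrict[OF finite_atLeastAtMost])
  also have "{1..n} \<inter> A = A"
    using assms by blast
  finally show ?thesis
    by simp
qed

end

theory Submission
  imports Defs "HOL-Analysis.Analysis"
begin

text \<open>
  Write \<open>R\<^sub>j(s, \<zeta>)\<close> for the sum of \<open>s\<^sup>k / k \<cdot> W\<^sub>A(\<zeta>)\<close>, \<open>k = |A|\<close>, over the sets \<open>A\<close> that
  contain \<open>j\<close>. The operator \<open>D\<^sub>j \<Delta>\<^sup>-\<^sup>1\<close> is multiplicative convolution with \<open>R\<^sub>j(1, \<cdot>)\<close>, and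
  \<open>R\<^sub>j(0, \<cdot>) = 0\<close>, so that \<open>R\<^sub>j(1, \<cdot>)\<close> is the integral of the \<open>\<theta>\<close>-derivative of
  \<open>R\<^sub>j(sin \<theta>, \<cdot>)\<close> over \<open>[0, \<pi>/2]\<close>. (With \<open>sin \<theta> = e\<^sup>-\<^sup>t\<close> this is the representation of
  \<open>\<Delta>\<^sup>-\<^sup>1\<close> as the integral of the heat semigroup.) The length of this interval is the constant
  \<open>\<pi>/2\<close>, and it remains to see that the vector of convolutions with these derivatives is a
  contraction on \<open>L\<^sub>p\<close> for every single \<open>\<theta>\<close>.

  The reason is that the derivative factors as
  \<open>\<mu>\<^sub>\<theta>(\<zeta>) (\<zeta>\<^sub>j - sin \<theta>) / cos \<theta>\<close>,
  where \<open>\<mu>\<^sub>\<theta>\<close> is the density of the product measure under which every coordinate has mean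
  \<open>sin \<theta>\<close>. The second factors, \<open>j = 1, \<dots>, n\<close>, are the coordinates normalised to mean zero and
  variance one, an orthonormal system for \<open>\<mu>\<^sub>\<theta>\<close>. Bessel's inequality therefore bounds the
  square function at \<open>\<epsilon>\<close> by the \<open>L\<^sub>2\<close>-norm of \<open>\<eta> \<mapsto> h(\<epsilon>\<eta>)\<close> for \<open>\<mu>\<^sub>\<theta>\<close>, hence by its
  \<open>L\<^sub>p\<close>-norm as \<open>p \<ge> 2\<close>, and averaging over \<open>\<epsilon>\<close> gives back the uniform measure. This is
  \<open>expect_biased_square_function_le\<close>.

  Minkowski's integral inequality and duality are replaced by the mean value theorem and
  convexity. Let \<open>X\<close> be the vector to be estimated and \<open>U\<^sub>\<theta>\<close> the vector of convolutions with the
  derivatives at \<open>\<theta>\<close>, and pair both with the gradient at \<open>X\<close> of the convex function \<open>E |\<cdot>|\<^sup>p\<close>.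
  At some angle the pairing with \<open>X\<close> equals the pairing with \<open>(\<pi>/2) U\<^sub>\<theta>\<close>, and then the tangent
  inequality \<open>L2_set_powr_above_tangent\<close> gives \<open>E |X|\<^sup>p \<le> E |(\<pi>/2) U\<^sub>\<theta>|\<^sup>p\<close>. Only inner
  products are used, so that real and complex functions are treated together, as functions with
  values in a real inner product space.
\<close>

section \<open>Convexity of powers\<close>

lemma powr_above_tangent:
  fixes a b r :: real
  assumes "0 \<le> a" "0 \<le> b" "1 \<le> r"
  shows "a powr r + r * a powr (r - 1) * (b - a) \<le> b powr r"
proof -
  \<comment> \<open>\<open>powr_convex\<close> covers positive arguments; if one of \<open>a\<close> and \<open>b\<close> is \<open>0\<close>, the claim is
    elementary (\<open>0 powr x = 0\<close> for every exponent).\<close>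
  consider "a = 0" | "a > 0" "b = 0" | "a > 0" "b > 0"
    using assms by linarith
  then show ?thesis
  proof cases
    case 1
    then show ?thesis by simp
  next
    case 2
    have "a powr r = a powr (r - 1) * a"
      using 2 by (simp add: powr_diff)
    then have "a powr r + r * a powr (r - 1) * (b - a) = (1 - r) * (a powr (r - 1) * a)"
      using 2 by (simp add: algebra_simps)
    also have "\<dots> \<le> 0"
      using assms by (intro mult_nonpos_nonneg) auto
    finally show ?thesis using 2 by simp
  next
    case 3
    have "b powr r - a powr r \<ge> (r * a powr (r - 1)) * (b - a)"
    proof (rule convex_on_imp_above_tangent[of "{0<..}"])
      show "convex_on {0<..} (\<lambda>x. x powr r)"
        using assms by (intro powr_convex)
      show "((\<lambda>x. x powr r) has_real_derivative r * a powr (r - 1)) (at a within {0<..})"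
        using 3 by (intro has_real_derivative_powr DERIV_subset[OF has_real_derivative_powr]) auto
    qed (use 3 in \<open>auto simp: interior_open\<close>)
    then show ?thesis by simp
  qed
qed

text \<open>
  Jensen's inequality: the average of the tangent at the mean is its value there.
\<close>

lemma powr_weighted_mean_le:
  fixes w b :: "'s \<Rightarrow> real" and r :: real
  assumes "1 \<le> r" and "sum w S = 1"
    and w: "\<And>s. s \<in> S \<Longrightarrow> 0 \<le> w s" and b: "\<And>s. s \<in> S \<Longrightarrow> 0 \<le> b s"
  shows "(\<Sum>s\<in>S. w s * b s) powr r \<le> (\<Sum>s\<in>S. w s * b s powr r)"
proof -
  define a where "a = (\<Sum>s\<in>S. w s * b s)"
  have "a \<ge> 0"
    unfolding a_def using w b by (intro sum_nonneg) auto
  have "a powr r = a powr r * sum w S + r * a powr (r - 1) * ((\<Sum>s\<in>S. w s * b s) - a * sum w S)"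
    using assms(2) by (simp flip: a_def)
  also have "\<dots> = (\<Sum>s\<in>S. w s * (a powr r + r * a powr (r - 1) * (b s - a)))"
    by (simp add: algebra_simps sum.distrib sum_subtractf sum_distrib_left sum_distrib_right)
  also have "\<dots> \<le> (\<Sum>s\<in>S. w s * b s powr r)"
    using w b \<open>a \<ge> 0\<close> assms(1) by (intro sum_mono mult_left_mono powr_above_tangent) auto
  finally show ?thesis unfolding a_def .
qed

text \<open>
  The tangent inequality for the convex function \<open>x \<mapsto> |x|\<^sup>p\<close> of a vector of vectors, whose
  gradient at \<open>x \<noteq> 0\<close> is \<open>p |x|\<^bsup>p - 2\<^esup> x\<close>. It follows from the scalar case, because
  \<open>\<langle>x, y\<rangle> \<le> |x| |y|\<close>.
\<close>

lemma L2_set_powr_above_tangent: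
  fixes x y :: "'j \<Rightarrow> 'a::real_inner" and p :: real and J :: "'j set"
  assumes "1 \<le> p"
  defines "a \<equiv> L2_set (\<lambda>j. norm (x j)) J"
  shows "a powr p + p * a powr (p - 2) * (\<Sum>j\<in>J. inner (x j) (y j - x j))
    \<le> L2_set (\<lambda>j. norm (y j)) J powr p"
proof -
  let ?b = "L2_set (\<lambda>j. norm (y j)) J"
  have a: "a \<ge> 0"
    by (simp add: a_def)
  have "(\<Sum>j\<in>J. inner (x j) (y j)) \<le> (\<Sum>j\<in>J. \<bar>norm (x j)\<bar> * \<bar>norm (y j)\<bar>)"
    by (intro sum_mono) (simp add: norm_cauchy_schwarz)
  also have "\<dots> \<le> a * ?b"
    unfolding a_def by (rule L2_set_mult_ineq)
  finally have cs: "(\<Sum>j\<in>J. inner (x j) (y j)) \<le> a * ?b" .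
  have sq: "(\<Sum>j\<in>J. inner (x j) (x j)) = a * a"
    by (simp add: a_def L2_set_def sum_nonneg power2_norm_eq_inner flip: power2_eq_square)
  have "a powr (p - 2) * (\<Sum>j\<in>J. inner (x j) (y j - x j)) \<le> a powr (p - 2) * (a * (?b - a))"
    using cs sq by (intro mult_left_mono) (auto simp: inner_diff_right sum_subtractf algebra_simps)
  also have "\<dots> = a powr (p - 1) * (?b - a)"
  proof (cases "a = 0")
    case False
    with a have "a powr (p - 1) = a powr ((p - 2) + 1)" by simp
    also have "\<dots> = a powr (p - 2) * a"
      using a False by (subst powr_add) auto
    finally show ?thesis by simp
  qed simp
  finally have "p * (a powr (p - 2) * (\<Sum>j\<in>J. inner (x j) (y j - x j)))
      \<le> p * (a powr (p - 1) * (?b - a))"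
    using assms(1) by (intro mult_left_mono) auto
  moreover have "a powr p + p * a powr (p - 1) * (?b - a) \<le> ?b powr p"
    using a assms(1) by (intro powr_above_tangent) auto
  ultimately show ?thesis by (simp add: mult.assoc)
qed

section \<open>Bessel's inequality for vector-valued functions\<close>

text \<open>
  The scalar proof carries over: expand the weighted square norm of the difference between \<open>h\<close> and
  its projection to the span of the orthonormal system \<open>u\<close>, with vectors as coefficients.
\<close>

lemma bessel_weighted_sum:
  fixes w :: "'s \<Rightarrow> real" and u :: "'j \<Rightarrow> 's \<Rightarrow> real" and h :: "'s \<Rightarrow> 'a::real_inner"
  assumes "finite J" and w: "\<And>s. s \<in> S \<Longrightarrow> 0 \<le> w s"
    and orth: "\<And>j k. j \<in> J \<Longrightarrow> k \<in> J \<Longrightarrow>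
      (\<Sum>s\<in>S. w s * u j s * u k s) = (if j = k then 1 else 0)"
  shows "(\<Sum>j\<in>J. (norm (\<Sum>s\<in>S. (w s * u j s) *\<^sub>R h s))\<^sup>2) \<le> (\<Sum>s\<in>S. w s * (norm (h s))\<^sup>2)"
proof -
  define c where "c j = (\<Sum>s\<in>S. (w s * u j s) *\<^sub>R h s)" for j
  define v where "v s = (\<Sum>j\<in>J. u j s *\<^sub>R c j)" for s
  have hv: "(\<Sum>s\<in>S. w s * inner (h s) (v s)) = (\<Sum>j\<in>J. inner (c j) (c j))"
  proof -
    have "(\<Sum>s\<in>S. w s * inner (h s) (v s)) = (\<Sum>s\<in>S. \<Sum>j\<in>J. w s * u j s * inner (h s) (c j))"
      by (simp add: v_def inner_sum_right sum_distrib_left mult.assoc)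
    also have "\<dots> = (\<Sum>j\<in>J. \<Sum>s\<in>S. w s * u j s * inner (h s) (c j))"
      by (rule sum.swap)
    also have "\<dots> = (\<Sum>j\<in>J. inner (\<Sum>s\<in>S. (w s * u j s) *\<^sub>R h s) (c j))"
      by (simp add: inner_sum_left)
    finally show ?thesis by (simp add: c_def)
  qed
  have vv: "(\<Sum>s\<in>S. w s * inner (v s) (v s)) = (\<Sum>j\<in>J. inner (c j) (c j))"
  proof -
    have "(\<Sum>s\<in>S. w s * inner (v s) (v s))
        = (\<Sum>s\<in>S. \<Sum>j\<in>J. \<Sum>k\<in>J. w s * u j s * u k s * inner (c k) (c j))"
      by (simp add: v_def inner_sum_right inner_sum_left sum_distrib_left mult.assoc mult.left_commute)
    also have "\<dots> = (\<Sum>j\<in>J. \<Sum>s\<in>S. \<Sum>k\<in>J. w s * u j s * u k s * inner (c k) (c j))"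
      by (rule sum.swap)
    also have "\<dots> = (\<Sum>j\<in>J. \<Sum>k\<in>J. \<Sum>s\<in>S. w s * u j s * u k s * inner (c k) (c j))"
      by (intro sum.cong refl sum.swap)
    also have "\<dots> = (\<Sum>j\<in>J. \<Sum>k\<in>J. (if j = k then 1 else 0) * inner (c k) (c j))"
      by (intro sum.cong refl) (simp add: orth flip: sum_distrib_right)
    also have "\<dots> = (\<Sum>j\<in>J. inner (c j) (c j))"
      using \<open>finite J\<close> by (simp add: if_distrib[of "\<lambda>x. x * _"] sum.delta cong: if_cong)
    finally show ?thesis .
  qed
  have "0 \<le> (\<Sum>s\<in>S. w s * (norm (h s - v s))\<^sup>2)"
    using w by (intro sum_nonneg) auto
  also have "\<dots> = (\<Sum>s\<in>S. w s * (norm (h s))\<^sup>2)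
      - 2 * (\<Sum>s\<in>S. w s * inner (h s) (v s)) + (\<Sum>s\<in>S. w s * inner (v s) (v s))"
    by (simp add: power2_norm_eq_inner inner_diff_left inner_diff_right inner_commute
        algebra_simps sum.distrib sum_subtractf sum_distrib_left)
  also have "\<dots> = (\<Sum>s\<in>S. w s * (norm (h s))\<^sup>2) - (\<Sum>j\<in>J. (norm (c j))\<^sup>2)"
    by (simp add: hv vv power2_norm_eq_inner)
  finally show ?thesis by (simp add: c_def)
qed

section \<open>Averages over the cube\<close>

abbreviation coord_mult :: "(nat \<Rightarrow> real) \<Rightarrow> (nat \<Rightarrow> real) \<Rightarrow> nat \<Rightarrow> real" (infixl "\<odot>" 70)
  where "\<epsilon> \<odot> \<eta> \<equiv> (\<lambda>i. \<epsilon> i * \<eta> i)"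

lemma finite_cube [simp]: "finite (cube n)"
  by (auto simp: cube_def intro: finite_PiE)

lemma card_cube: "card (cube n) = 2 ^ n"
  by (simp add: cube_def card_PiE numeral_2_eq_2)

lemma cube_coord: "\<epsilon> \<in> cube n \<Longrightarrow> i \<in> {1..n} \<Longrightarrow> \<epsilon> i = - 1 \<or> \<epsilon> i = 1"
  by (auto simp: cube_def PiE_iff)

lemma expect_cong: "(\<And>\<epsilon>. \<epsilon> \<in> cube n \<Longrightarrow> f \<epsilon> = g \<epsilon>) \<Longrightarrow> expect n f = expect n g"
  by (simp add: expect_def)

lemma expect_mono:
  fixes f g :: "(nat \<Rightarrow> real) \<Rightarrow> real"
  shows "(\<And>\<epsilon>. \<epsilon> \<in> cube n \<Longrightarrow> f \<epsilon> \<le> g \<epsilon>) \<Longrightarrow> expect n f \<le> expect n g"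
  unfolding expect_def by (auto intro!: mult_left_mono sum_mono)

lemma expect_eq_scaleR_sum: "expect n f = (1 / 2 ^ n) *\<^sub>R (\<Sum>\<epsilon>\<in>cube n. f \<epsilon>)"
  by (simp add: expect_def card_cube inverse_eq_divide)

lemma expect_real: "expect n f = (\<Sum>\<epsilon>\<in>cube n. f \<epsilon> / 2 ^ n)" for f :: "_ \<Rightarrow> real"
  by (simp add: expect_eq_scaleR_sum sum_divide_distrib)

text \<open>
  The coordinates are independent, and multiplication by \<open>\<epsilon>\<close> preserves the uniform measure.
\<close>

lemma expect_prod:
  assumes "\<epsilon> \<in> cube n"
  shows "expect n (\<lambda>\<eta>. \<Prod>i\<in>{1..n}. f i (\<epsilon> i * \<eta> i)) = (\<Prod>i\<in>{1..n}. (f i 1 + f i (- 1)) / 2 :: real)"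
proof -
  have "(\<Sum>\<eta>\<in>cube n. \<Prod>i\<in>{1..n}. f i (\<epsilon> i * \<eta> i)) = (\<Prod>i\<in>{1..n}. \<Sum>y\<in>{-1, 1}. f i (\<epsilon> i * y))"
    unfolding cube_def by (rule prod_sum_PiE[symmetric]) auto
  also have "\<dots> = (\<Prod>i\<in>{1..n}. f i 1 + f i (- 1))"
  proof (rule prod.cong[OF refl])
    fix i assume "i \<in> {1..n}"
    then show "(\<Sum>y\<in>{-1, 1}. f i (\<epsilon> i * y)) = f i 1 + f i (- 1)"
      using cube_coord[OF assms, of i] by (auto simp: add.commute)
  qed
  finally show ?thesis
    by (simp add: expect_eq_scaleR_sum prod_dividef)
qed

section \<open>The biased measure on the cube\<close>

text \<open>
  For \<open>|s| \<le> 1\<close> this is the density, with respect to the uniform measure, of the product measure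
  under which each coordinate has mean \<open>s\<close>.
\<close>

definition bias_density :: "nat \<Rightarrow> real \<Rightarrow> (nat \<Rightarrow> real) \<Rightarrow> real" where
  "bias_density n s \<zeta> = (\<Prod>i\<in>{1..n}. 1 + s * \<zeta> i)"

lemma bias_density_nonneg:
  assumes "\<bar>s\<bar> \<le> 1" "\<epsilon> \<in> cube n" "\<eta> \<in> cube n"
  shows "0 \<le> bias_density n s (\<epsilon> \<odot> \<eta>)"
  unfolding bias_density_def
proof (rule prod_nonneg)
  fix i assume i: "i \<in> {1..n}"
  show "0 \<le> 1 + s * (\<epsilon> i * \<eta> i)"
    using cube_coord[OF assms(2) i] cube_coord[OF assms(3) i] assms(1) by auto
qed

lemma expect_bias_density:
  assumes "\<epsilon> \<in> cube n"
  shows "expect n (\<lambda>\<eta>. bias_density n s (\<epsilon> \<odot> \<eta>)) = 1"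
  unfolding bias_density_def using expect_prod[OF assms, of "\<lambda>_ y. 1 + s * y"] by simp

text \<open>
  Under the biased measure the coordinates are independent with mean \<open>s\<close> and variance
  \<open>1 - s\<^sup>2 = c\<^sup>2\<close>.
\<close>

lemma expect_bias_orthonormal:
  fixes s c :: real
  assumes "\<epsilon> \<in> cube n" "j \<in> {1..n}" "k \<in> {1..n}" and sc: "s\<^sup>2 + c\<^sup>2 = 1" "c \<noteq> 0"
  shows "expect n (\<lambda>\<eta>. bias_density n s (\<epsilon> \<odot> \<eta>) * ((\<epsilon> j * \<eta> j - s) / c) * ((\<epsilon> k * \<eta> k - s) / c))
    = (if j = k then 1 else 0)"
proof -
  \<comment> \<open>The integrand is a product over the coordinates; those other than \<open>j\<close> and \<open>k\<close>
    contribute the total mass \<open>1\<close> of a biased sign.\<close>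
  define f where "f i y = (1 + s * y) * (if i = j then (y - s) / c else 1)
      * (if i = k then (y - s) / c else 1)" for i y
  have "expect n (\<lambda>\<eta>. bias_density n s (\<epsilon> \<odot> \<eta>) * ((\<epsilon> j * \<eta> j - s) / c) * ((\<epsilon> k * \<eta> k - s) / c))
      = expect n (\<lambda>\<eta>. \<Prod>i\<in>{1..n}. f i (\<epsilon> i * \<eta> i))"
    using assms(2,3) by (simp add: f_def prod.distrib bias_density_def prod.delta)
  also have "\<dots> = (\<Prod>i\<in>{1..n}. (f i 1 + f i (- 1)) / 2)"
    by (rule expect_prod[OF assms(1)])
  also have "\<dots> = (\<Prod>i\<in>{1..n}. if i = j \<and> j \<noteq> k \<or> i = k \<and> j \<noteq> k then 0 else 1)"
  proof (rule prod.cong[OF refl])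
    fix i
    have c2: "c * c = 1 - s * s" using sc by (simp add: power2_eq_square)
    show "(f i 1 + f i (- 1)) / 2 = (if i = j \<and> j \<noteq> k \<or> i = k \<and> j \<noteq> k then 0 else 1)"
    proof (cases "i = j \<and> i = k")
      case True
      have "(f i 1 + f i (- 1)) / 2 = ((1 + s) * (1 - s)\<^sup>2 + (1 - s) * (1 + s)\<^sup>2) / (2 * (c * c))"
        using True by (simp add: f_def power2_eq_square add_divide_distrib) (simp add: algebra_simps)
      also have "(1 + s) * (1 - s)\<^sup>2 + (1 - s) * (1 + s)\<^sup>2 = 2 * (c * c)"
        by (simp add: c2) algebra
      finally show ?thesis using True sc by simp
    qed (use sc in \<open>auto simp: f_def field_simps\<close>)
  qed
  also have "\<dots> = (if j = k then 1 else 0)"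
    using assms(2) by (auto intro!: prod_zero)
  finally show ?thesis .
qed

text \<open>
  The contraction at a fixed bias. At each \<open>\<epsilon>\<close>, the entries are the coefficients of
  \<open>h\<close> with respect to an orthonormal system of the measure \<open>w \<epsilon>\<close>, so Bessel and then Jensen with
  exponent \<open>p / 2 \<ge> 1\<close> apply. The average of \<open>w \<epsilon>\<close> over \<open>\<epsilon>\<close> is uniform because \<open>w\<close> is
  symmetric in its two arguments.
\<close>

lemma expect_biased_square_function_le:
  fixes h :: "(nat \<Rightarrow> real) \<Rightarrow> 'a::real_inner" and s c p :: real
  assumes "2 \<le> p" and sc: "s\<^sup>2 + c\<^sup>2 = 1" "c \<noteq> 0"
  shows "expect n (\<lambda>\<epsilon>. L2_set (\<lambda>j. norm (expect n (\<lambda>\<eta>.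
      (bias_density n s (\<epsilon> \<odot> \<eta>) * ((\<epsilon> j * \<eta> j - s) / c)) *\<^sub>R h \<eta>))) {1..n} powr p)
    \<le> expect n (\<lambda>\<eta>. norm (h \<eta>) powr p)"
proof -
  have s1: "\<bar>s\<bar> \<le> 1"
    using sc(1) zero_le_power2[of c] by (subst abs_square_le_1[symmetric]) linarith
  define w where "w \<epsilon> \<eta> = bias_density n s (\<epsilon> \<odot> \<eta>) / 2 ^ n" for \<epsilon> \<eta>
  define g where "g \<epsilon> j = expect n (\<lambda>\<eta>.
      (bias_density n s (\<epsilon> \<odot> \<eta>) * ((\<epsilon> j * \<eta> j - s) / c)) *\<^sub>R h \<eta>)" for \<epsilon> j
  have w0: "0 \<le> w \<epsilon> \<eta>" if "\<epsilon> \<in> cube n" "\<eta> \<in> cube n" for \<epsilon> \<eta>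
    using bias_density_nonneg[OF s1 that] by (simp add: w_def)
  have w1: "(\<Sum>\<eta>\<in>cube n. w \<epsilon> \<eta>) = 1" if "\<epsilon> \<in> cube n" for \<epsilon>
    using expect_bias_density[OF that, of s] by (simp add: w_def expect_real)
  have w_sym: "w \<epsilon> \<eta> = w \<eta> \<epsilon>" for \<epsilon> \<eta>
    by (simp add: w_def mult.commute)
  have pointwise: "L2_set (\<lambda>j. norm (g \<epsilon> j)) {1..n} powr p
      \<le> (\<Sum>\<eta>\<in>cube n. w \<epsilon> \<eta> * norm (h \<eta>) powr p)" if e: "\<epsilon> \<in> cube n" for \<epsilon>
  proof -
    have g: "g \<epsilon> j = (\<Sum>\<eta>\<in>cube n. (w \<epsilon> \<eta> * ((\<epsilon> j * \<eta> j - s) / c)) *\<^sub>R h \<eta>)" for j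
      by (simp add: g_def w_def expect_eq_scaleR_sum scaleR_sum_right field_simps)
    have "(\<Sum>j\<in>{1..n}. (norm (g \<epsilon> j))\<^sup>2) \<le> (\<Sum>\<eta>\<in>cube n. w \<epsilon> \<eta> * (norm (h \<eta>))\<^sup>2)"
      unfolding g
    proof (rule bessel_weighted_sum)
      fix j k assume "j \<in> {1..n}" "k \<in> {1..n}"
      from expect_bias_orthonormal[OF e this sc]
      show "(\<Sum>\<eta>\<in>cube n. w \<epsilon> \<eta> * ((\<epsilon> j * \<eta> j - s) / c) * ((\<epsilon> k * \<eta> k - s) / c))
          = (if j = k then 1 else 0)"
        by (cases "j = k") (simp_all add: expect_real w_def mult_ac)
    qed (use w0[OF e] in auto)
    then have "(\<Sum>j\<in>{1..n}. (norm (g \<epsilon> j))\<^sup>2) powr (p / 2)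
        \<le> (\<Sum>\<eta>\<in>cube n. w \<epsilon> \<eta> * (norm (h \<eta>))\<^sup>2) powr (p / 2)"
      using assms(1) by (intro powr_mono2) (auto intro: sum_nonneg)
    also have "\<dots> \<le> (\<Sum>\<eta>\<in>cube n. w \<epsilon> \<eta> * ((norm (h \<eta>))\<^sup>2) powr (p / 2))"
      using assms(1) w0[OF e] w1[OF e] by (intro powr_weighted_mean_le) auto
    also have "\<dots> = (\<Sum>\<eta>\<in>cube n. w \<epsilon> \<eta> * norm (h \<eta>) powr p)"
      by (simp add: powr_powr flip: powr_numeral)
    also have "(\<Sum>j\<in>{1..n}. (norm (g \<epsilon> j))\<^sup>2) powr (p / 2) = L2_set (\<lambda>j. norm (g \<epsilon> j)) {1..n} powr p"
      by (simp add: L2_set_def powr_powr sum_nonneg flip: powr_half_sqrt)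
    finally show ?thesis .
  qed
  have "expect n (\<lambda>\<epsilon>. L2_set (\<lambda>j. norm (g \<epsilon> j)) {1..n} powr p)
      \<le> expect n (\<lambda>\<epsilon>. \<Sum>\<eta>\<in>cube n. w \<epsilon> \<eta> * norm (h \<eta>) powr p)"
    by (rule expect_mono) (rule pointwise)
  also have "\<dots> = (\<Sum>\<eta>\<in>cube n. \<Sum>\<epsilon>\<in>cube n. w \<epsilon> \<eta> * norm (h \<eta>) powr p / 2 ^ n)"
    unfolding expect_real sum_divide_distrib by (rule sum.swap)
  also have "\<dots> = (\<Sum>\<eta>\<in>cube n. (\<Sum>\<epsilon>\<in>cube n. w \<eta> \<epsilon>) * norm (h \<eta>) powr p / 2 ^ n)"
    by (simp add: sum_distrib_right sum_divide_distrib w_sym)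
  also have "\<dots> = expect n (\<lambda>\<eta>. norm (h \<eta>) powr p)"
    by (simp add: w1 expect_real)
  finally show ?thesis by (simp add: g_def)
qed

section \<open>The kernel of the discrete Riesz transforms\<close>

text \<open>
  The parameter \<open>s\<close> interpolates between \<open>0\<close> and the kernel of \<open>D\<^sub>j \<Delta>\<^sup>-\<^sup>1\<close>, which is the case
  \<open>s = 1\<close> (\<open>discrete_deriv_laplacian_inv\<close>). Differentiating in \<open>s\<close> cancels the weight
  \<open>1 / card A\<close>, which leaves a product of first-order factors.
\<close>

definition riesz_kernel :: "nat \<Rightarrow> nat \<Rightarrow> real \<Rightarrow> (nat \<Rightarrow> real) \<Rightarrow> real" where
  "riesz_kernel n j s \<zeta> = (\<Sum>A | A \<subseteq> {1..n} \<and> j \<in> A. s ^ card A / real (card A) * walsh A \<zeta>)"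

lemma riesz_kernel_0: "riesz_kernel n j 0 \<zeta> = 0"
  unfolding riesz_kernel_def
  by (rule sum.neutral) (auto simp: card_gt_0_iff intro: finite_subset)

lemma walsh_coord_mult: "walsh A (\<epsilon> \<odot> \<eta>) = walsh A \<epsilon> * walsh A \<eta>"
  by (simp add: walsh_def prod.distrib)

text \<open>
  \<open>D\<^sub>j\<close> keeps exactly the Walsh functions whose index set contains \<open>j\<close>; inserting the definition
  of the Fourier coefficients turns the remaining sum into an average against \<open>h\<close>.
\<close>

lemma discrete_deriv_laplacian_inv:
  fixes h :: "(nat \<Rightarrow> real) \<Rightarrow> 'a::real_vector"
  shows "discrete_deriv j (laplacian_inv n h) \<epsilon> = expect n (\<lambda>\<eta>. riesz_kernel n j 1 (\<epsilon> \<odot> \<eta>) *\<^sub>R h \<eta>)"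
proof -
  have "discrete_deriv j (laplacian_inv n h) \<epsilon>
      = (\<Sum>A\<in>Pow {1..n} - {{}}. (discrete_deriv j (walsh A) \<epsilon> / real (card A)) *\<^sub>R fourier_coeff n h A)"
    unfolding discrete_deriv_def laplacian_inv_def
    by (simp add: scaleR_sum_right algebra_simps diff_divide_distrib flip: sum_subtractf)
  also have "\<dots> = (\<Sum>A\<in>Pow {1..n} - {{}}. if j \<in> A then (walsh A \<epsilon> / real (card A)) *\<^sub>R fourier_coeff n h A else 0)"
    by (rule sum.cong) (auto simp: discrete_deriv_walsh finite_subset[OF _ finite_atLeastAtMost])
  also have "\<dots> = (\<Sum>A | A \<subseteq> {1..n} \<and> j \<in> A. (walsh A \<epsilon> / real (card A)) *\<^sub>R fourier_coeff n h A)"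
    by (rule sum.mono_neutral_cong_right) (auto intro: finite_subset)
  also have "\<dots> = (\<Sum>A | A \<subseteq> {1..n} \<and> j \<in> A. \<Sum>\<eta>\<in>cube n.
      (1 / 2 ^ n) *\<^sub>R (1 / real (card A) * walsh A (\<epsilon> \<odot> \<eta>)) *\<^sub>R h \<eta>)"
    by (simp add: fourier_coeff_def expect_eq_scaleR_sum scaleR_sum_right walsh_coord_mult field_simps)
  also have "\<dots> = expect n (\<lambda>\<eta>. riesz_kernel n j 1 (\<epsilon> \<odot> \<eta>) *\<^sub>R h \<eta>)"
    by (subst sum.swap)
      (simp add: riesz_kernel_def expect_eq_scaleR_sum scaleR_sum_right scaleR_sum_left field_simps)
  finally show ?thesis .
qed

lemma riesz_kernel_has_derivative:
  assumes "j \<in> {1..n}"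
  shows "((\<lambda>s. riesz_kernel n j s \<zeta>) has_real_derivative \<zeta> j * (\<Prod>i\<in>{1..n} - {j}. 1 + s * \<zeta> i)) (at s)"
proof -
  have fin: "finite A" if "A \<subseteq> {1..n}" for A
    using that finite_subset by blast
  have "((\<lambda>s. riesz_kernel n j s \<zeta>) has_real_derivative
      (\<Sum>A | A \<subseteq> {1..n} \<and> j \<in> A. s ^ (card A - 1) * walsh A \<zeta>)) (at s)"
    unfolding riesz_kernel_def
  proof (rule DERIV_sum)
    fix A assume "A \<in> {A. A \<subseteq> {1..n} \<and> j \<in> A}"
    then have "card A \<noteq> 0" using fin by auto
    then show "((\<lambda>s. s ^ card A / real (card A) * walsh A \<zeta>) has_real_derivative
        s ^ (card A - 1) * walsh A \<zeta>) (at s)"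
      by (auto intro!: derivative_eq_intros)
  qed
  \<comment> \<open>With \<open>A = insert j B\<close> this is the expansion of a product over \<open>{1..n} - {j}\<close>.\<close>
  also have "(\<Sum>A | A \<subseteq> {1..n} \<and> j \<in> A. s ^ (card A - 1) * walsh A \<zeta>)
      = (\<Sum>B\<in>Pow ({1..n} - {j}). \<zeta> j * (s ^ card B * walsh B \<zeta>))"
  proof (rule sum.reindex_bij_witness[of _ "insert j" "\<lambda>A. A - {j}"])
    fix A assume "A \<in> {A. A \<subseteq> {1..n} \<and> j \<in> A}"
    then show "\<zeta> j * (s ^ card (A - {j}) * walsh (A - {j}) \<zeta>) = s ^ (card A - 1) * walsh A \<zeta>"
      using fin by (simp add: walsh_def prod.remove[of A j])
  qed (use assms in auto)
  also have "\<dots> = \<zeta> j * (\<Prod>i\<in>{1..n} - {j}. s * \<zeta> i + 1)"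
    by (simp add: prod_add sum_distrib_left walsh_def prod.distrib)
  finally show ?thesis by (simp add: add.commute)
qed

text \<open>
  For a sign \<open>\<zeta>\<^sub>j\<close> there is the identity \<open>(1 + s \<zeta>\<^sub>j) (\<zeta>\<^sub>j - s) = (1 - s\<^sup>2) \<zeta>\<^sub>j\<close>. By
  \<open>riesz_kernel_has_derivative\<close> the right-hand side below, for \<open>s = sin \<theta>\<close> and \<open>c = cos \<theta>\<close>, is
  the derivative of \<open>riesz_kernel n j (sin \<theta>) \<zeta>\<close> in \<open>\<theta>\<close>; this is why the angle is the right
  parameter.
\<close>

lemma bias_density_times_coord:
  fixes s c :: real
  assumes "j \<in> {1..n}" "\<zeta> j = - 1 \<or> \<zeta> j = 1" "s\<^sup>2 + c\<^sup>2 = 1" "c \<noteq> 0"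
  shows "bias_density n s \<zeta> * ((\<zeta> j - s) / c) = c * (\<zeta> j * (\<Prod>i\<in>{1..n} - {j}. 1 + s * \<zeta> i))"
proof -
  have "(1 + s * \<zeta> j) * (\<zeta> j - s) = (c * c) * \<zeta> j"
    using assms(2,3) by (auto simp: power2_eq_square algebra_simps)
  then have coord: "(1 + s * \<zeta> j) * ((\<zeta> j - s) / c) = c * \<zeta> j"
    using assms(4) by (simp add: field_simps)
  have "bias_density n s \<zeta> = (1 + s * \<zeta> j) * (\<Prod>i\<in>{1..n} - {j}. 1 + s * \<zeta> i)"
    unfolding bias_density_def using assms(1) by (subst prod.remove[of _ j]) auto
  then have "bias_density n s \<zeta> * ((\<zeta> j - s) / c)
      = ((1 + s * \<zeta> j) * ((\<zeta> j - s) / c)) * (\<Prod>i\<in>{1..n} - {j}. 1 + s * \<zeta> i)"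
    by (simp only: mult_ac)
  then show ?thesis
    by (simp only: coord mult_ac)
qed

section \<open>The Riesz transform bound\<close>

text \<open>
  Here the angle is chosen and the three ingredients are combined: the derivative \<open>U\<close> of the
  interpolation \<open>V\<close> from \<open>0\<close> to \<open>X\<close>, the tangent inequality at \<open>X\<close>, and the contraction for
  \<open>U\<close>. The estimate is for \<open>p\<close>-th powers of norms.
\<close>

lemma expect_riesz_square_function_le:
  fixes h :: "(nat \<Rightarrow> real) \<Rightarrow> 'a::real_inner" and p :: real
  assumes "2 \<le> p"
  shows "expect n (\<lambda>\<epsilon>. L2_set (\<lambda>j. norm (discrete_deriv j (laplacian_inv n h) \<epsilon>)) {1..n} powr p)
    \<le> (pi / 2) powr p * expect n (\<lambda>\<eta>. norm (h \<eta>) powr p)"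
proof -
  define X where "X \<epsilon> j = discrete_deriv j (laplacian_inv n h) \<epsilon>" for \<epsilon> j
  define a where "a \<epsilon> = L2_set (\<lambda>j. norm (X \<epsilon> j)) {1..n}" for \<epsilon>
  define V where "V \<theta> \<epsilon> j = expect n (\<lambda>\<eta>. riesz_kernel n j (sin \<theta>) (\<epsilon> \<odot> \<eta>) *\<^sub>R h \<eta>)" for \<theta> \<epsilon> j
  define U where "U \<theta> \<epsilon> j = expect n (\<lambda>\<eta>.
    (cos \<theta> * (\<epsilon> j * \<eta> j * (\<Prod>i\<in>{1..n} - {j}. 1 + sin \<theta> * (\<epsilon> i * \<eta> i)))) *\<^sub>R h \<eta>)" for \<theta> \<epsilon> j
  \<comment> \<open>Up to constant factors, \<open>F\<close> pairs \<open>V\<close> with the gradient of \<open>E |\<cdot>|\<^sup>p\<close> at \<open>X\<close>.\<close>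
  define F where "F \<theta> = (\<Sum>\<epsilon>\<in>cube n. a \<epsilon> powr (p - 2) * (\<Sum>j\<in>{1..n}. inner (X \<epsilon> j) (V \<theta> \<epsilon> j)))" for \<theta>
  define F' where "F' \<theta> = (\<Sum>\<epsilon>\<in>cube n. a \<epsilon> powr (p - 2) * (\<Sum>j\<in>{1..n}. inner (X \<epsilon> j) (U \<theta> \<epsilon> j)))" for \<theta>
  have inner_expect: "inner x (expect n (\<lambda>\<eta>. k \<eta> *\<^sub>R h \<eta>)) = (\<Sum>\<eta>\<in>cube n. k \<eta> * (inner x (h \<eta>) / 2 ^ n))"
    for x k by (simp add: expect_eq_scaleR_sum inner_sum_right sum_divide_distrib)
  have "(F has_real_derivative F' \<theta>) (at \<theta>)" for \<theta>
  proof -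
    have "((\<lambda>\<theta>. riesz_kernel n j (sin \<theta>) \<zeta>) has_real_derivative
        cos \<theta> * (\<zeta> j * (\<Prod>i\<in>{1..n} - {j}. 1 + sin \<theta> * \<zeta> i))) (at \<theta>)" if "j \<in> {1..n}" for j \<zeta>
      using DERIV_chain2[OF riesz_kernel_has_derivative[OF that, where \<zeta> = \<zeta> and s = "sin \<theta>"] DERIV_sin] by (simp add: mult.commute)
    then show ?thesis
      unfolding F_def F'_def V_def U_def inner_expect
      by (intro DERIV_sum DERIV_cmult DERIV_cmult_right) auto
  qed
  \<comment> \<open>Since \<open>V\<close> runs from \<open>0\<close> to \<open>X\<close>, at such an angle the gradient is orthogonal to
    \<open>(\<pi>/2) U - X\<close>, and the linear term of the tangent inequality vanishes on average.\<close>
  then obtain \<theta> where \<theta>: "0 < \<theta>" "\<theta> < pi / 2" and mvt: "F (pi / 2) - F 0 = (pi / 2 - 0) * F' \<theta>"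
    using MVT2[of 0 "pi / 2" F F'] pi_half_gt_zero by blast
  have "F 0 = 0"
    by (simp add: F_def V_def riesz_kernel_0 expect_def)
  moreover have "F (pi / 2) = (\<Sum>\<epsilon>\<in>cube n. a \<epsilon> powr (p - 2) * (\<Sum>j\<in>{1..n}. inner (X \<epsilon> j) (X \<epsilon> j)))"
    by (simp add: F_def V_def X_def discrete_deriv_laplacian_inv)
  ultimately have orth: "(\<Sum>\<epsilon>\<in>cube n. a \<epsilon> powr (p - 2) *
      (\<Sum>j\<in>{1..n}. inner (X \<epsilon> j) ((pi / 2) *\<^sub>R U \<theta> \<epsilon> j - X \<epsilon> j))) = 0"
    using mvt by (simp add: F'_def inner_diff_right sum_subtractf algebra_simps sum_distrib_left)
  have "cos \<theta> > 0"
    using \<theta> by (intro cos_gt_zero) auto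
  have U: "U \<theta> \<epsilon> j = expect n (\<lambda>\<eta>.
      (bias_density n (sin \<theta>) (\<epsilon> \<odot> \<eta>) * ((\<epsilon> j * \<eta> j - sin \<theta>) / cos \<theta>)) *\<^sub>R h \<eta>)"
    if "\<epsilon> \<in> cube n" "j \<in> {1..n}" for \<epsilon> j
  proof -
    have "bias_density n (sin \<theta>) (\<epsilon> \<odot> \<eta>) * ((\<epsilon> j * \<eta> j - sin \<theta>) / cos \<theta>)
        = cos \<theta> * (\<epsilon> j * \<eta> j * (\<Prod>i\<in>{1..n} - {j}. 1 + sin \<theta> * (\<epsilon> i * \<eta> i)))"
      if "\<eta> \<in> cube n" for \<eta>
      using cube_coord[OF \<open>\<epsilon> \<in> cube n\<close> \<open>j \<in> {1..n}\<close>] cube_coord[OF that \<open>j \<in> {1..n}\<close>]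
        \<open>cos \<theta> > 0\<close> \<open>j \<in> {1..n}\<close>
      by (intro bias_density_times_coord) auto
    then show ?thesis
      unfolding U_def expect_def by simp
  qed
  have "expect n (\<lambda>\<epsilon>. a \<epsilon> powr p) = expect n (\<lambda>\<epsilon>. a \<epsilon> powr p + p * a \<epsilon> powr (p - 2) *
      (\<Sum>j\<in>{1..n}. inner (X \<epsilon> j) ((pi / 2) *\<^sub>R U \<theta> \<epsilon> j - X \<epsilon> j)))"
    using orth by (simp add: expect_def sum.distrib mult.assoc flip: sum_distrib_left)
  also have "\<dots> \<le> expect n (\<lambda>\<epsilon>. L2_set (\<lambda>j. norm ((pi / 2) *\<^sub>R U \<theta> \<epsilon> j)) {1..n} powr p)"
    unfolding a_def using assms by (intro expect_mono L2_set_powr_above_tangent) auto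
  also have "\<dots> = expect n (\<lambda>\<epsilon>. (pi / 2) powr p * L2_set (\<lambda>j. norm (U \<theta> \<epsilon> j)) {1..n} powr p)"
  proof -
    have "L2_set (\<lambda>j. norm ((pi / 2) *\<^sub>R U \<theta> \<epsilon> j)) {1..n} = pi / 2 * L2_set (\<lambda>j. norm (U \<theta> \<epsilon> j)) {1..n}"
      for \<epsilon>
      by (subst L2_set_right_distrib) simp_all
    then show ?thesis
      by (simp only: powr_mult)
  qed
  also have "\<dots> = (pi / 2) powr p * expect n (\<lambda>\<epsilon>. L2_set (\<lambda>j. norm (U \<theta> \<epsilon> j)) {1..n} powr p)"
    by (simp add: expect_def sum_distrib_left mult.left_commute)
  also have "expect n (\<lambda>\<epsilon>. L2_set (\<lambda>j. norm (U \<theta> \<epsilon> j)) {1..n} powr p)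
      = expect n (\<lambda>\<epsilon>. L2_set (\<lambda>j. norm (expect n (\<lambda>\<eta>. (bias_density n (sin \<theta>) (\<epsilon> \<odot> \<eta>)
          * ((\<epsilon> j * \<eta> j - sin \<theta>) / cos \<theta>)) *\<^sub>R h \<eta>))) {1..n} powr p)"
    by (rule expect_cong) (simp add: U cong: L2_set_cong_simp)
  also have "\<dots> \<le> expect n (\<lambda>\<eta>. norm (h \<eta>) powr p)"
    using \<open>cos \<theta> > 0\<close> assms by (intro expect_biased_square_function_le) auto
  finally show ?thesis
    by (simp add: a_def X_def mult_left_mono)
qed

lemma Lp_norm_riesz_square_function_le:
  fixes h :: "(nat \<Rightarrow> real) \<Rightarrow> 'a::real_inner" and p :: real
  assumes "2 \<le> p"
  shows "Lp_norm n p (\<lambda>\<epsilon>. sqrt (\<Sum>j=1..n. (norm (discrete_deriv j (laplacian_inv n h) \<epsilon>))\<^sup>2))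
    \<le> pi / 2 * Lp_norm n p h"
proof -
  have nonneg: "0 \<le> expect n (\<lambda>\<epsilon>. f \<epsilon> powr p)" for f :: "(nat \<Rightarrow> real) \<Rightarrow> real"
    by (simp add: expect_def sum_nonneg)
  have "Lp_norm n p (\<lambda>\<epsilon>. sqrt (\<Sum>j=1..n. (norm (discrete_deriv j (laplacian_inv n h) \<epsilon>))\<^sup>2))
      = expect n (\<lambda>\<epsilon>. L2_set (\<lambda>j. norm (discrete_deriv j (laplacian_inv n h) \<epsilon>)) {1..n} powr p) powr (1 / p)"
    by (simp add: Lp_norm_def L2_set_def sum_nonneg)
  also have "\<dots> \<le> ((pi / 2) powr p * expect n (\<lambda>\<eta>. norm (h \<eta>) powr p)) powr (1 / p)"
    using assms by (intro powr_mono2 expect_riesz_square_function_le nonneg) auto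
  also have "\<dots> = pi / 2 * Lp_norm n p h"
    using assms nonneg by (simp add: Lp_norm_def powr_mult powr_powr)
  finally show ?thesis .
qed

theorem theorem2p5:
  fixes p :: real and n :: nat
  assumes "2 \<le> p"
  shows "(\<forall>h :: (nat \<Rightarrow> real) \<Rightarrow> real. expect n h = 0 \<longrightarrow>
            Lp_norm n p (\<lambda>\<epsilon>. sqrt (\<Sum>j=1..n. (norm (discrete_deriv j (laplacian_inv n h) \<epsilon>))\<^sup>2))
              \<le> pi / 2 * Lp_norm n p h)
       \<and> (\<forall>h :: (nat \<Rightarrow> real) \<Rightarrow> complex. expect n h = 0 \<longrightarrow>
            Lp_norm n p (\<lambda>\<epsilon>. sqrt (\<Sum>j=1..n. (norm (discrete_deriv j (laplacian_inv n h) \<epsilon>))\<^sup>2))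
              \<le> pi / 2 * Lp_norm n p h)"
  by (intro conjI allI impI Lp_norm_riesz_square_function_le assms)

end
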